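(* There is an equivalence of categories $$\mathbf{SchRG}(\mathbf{RPOGrp})\simeq\mathcal S\text{-}\mathbf{PXMod}(\mathbf{RPOGrp})$$ between the category of Schreier internal reflexive graphs in $\mathbf{RPOGrp}$ and the category of $\mathcal S$-precrossed modules of right-preordered groups.
   Context: Groups are written additively and need not be abelian. A right-preordered group is a pair $(G,P_G)$ with $G$ a group and $P_G$ a submonoid of $G$ (the positive cone). Morphisms $(G,P_G)\to(H,P_H)$ in $\mathbf{RPOGrp}$ are group homomorphisms $f$ with $f(P_G)\subseteq P_H$. A split epimorphism $d:(X_1,P_1)\to(X_0,P_0)$ with section $e$ in $\mathbf{RPOGrp}$ is Schreier if $a-e(d(a))\in P_1$ for all $a\in P_1$. A Schreier reflexive graph is a reflexive graph $d,c:X_1\rightrightarrows X_0$, $e:X_0\to X_1$ ($de=ce=\mathrm{id}$) in $\mathbf{RPOGrp}$ such that $(d,e)$ is a Schreier split epimorphism. With the usual morphisms of reflexive graphs (pairs $f_0:X_0\to X_0'$, $f_1:X_1\to X_1'$ commuting with $d,c,e$) they form the category $\mathbf{SchRG}(\mathbf{RPOGrp})$. For a right-preordered group $(K,P_K)$, $[K,P_K]_{\mathcal S}:=(\mathrm{Aut}(K),\mathrm{Aut}(K)_{\le})$, with $\mathrm{Aut}(K)$ the group of all group automorphisms of $K$ and $\mathrm{Aut}(K)_\le$ the submonoid of those $f$ with $f(P_K)\subseteq P_K$. An $\mathcal S$-precrossed module consists of right-preordered groups $(X_0,P_0)$, $(X_1,P_1)$ and morphisms $\partial:(X_1,P_1)\to(X_0,P_0)$,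 $\mu:(X_0,P_0)\to[X_1,P_1]_{\mathcal S}$ of $\mathbf{RPOGrp}$ such that $\partial(\mu(x)(a))=x+\partial(a)-x$ for all $a\in X_1,x\in X_0$. Morphisms are pairs $(\gamma_0:X_0\to X_0',\gamma_1:X_1\to X_1')$ of morphisms of $\mathbf{RPOGrp}$ with $\gamma_0\partial=\partial'\gamma_1$ and $\gamma_1(\mu(x)(a))=\mu'(\gamma_0(x))(\gamma_1(a))$ for all $x\in X_0$, $a\in X_1$. They form the category $\mathcal S\text{-}\mathbf{PXMod}(\mathbf{RPOGrp})$. *)

theory Defs
  imports "HOL-Algebra.Bij"
begin

section \<open>Categories and equivalences\<close>

text \<open>
  Hom-sets of different pairs of objects need not be disjoint; composition and the action of a
  functor on morphisms therefore take the objects involved as arguments.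
  \<open>Comp C x y z g f\<close> is the composite \<open>g \<circ> f\<close> of \<open>f : x \<rightarrow> y\<close> and \<open>g : y \<rightarrow> z\<close>.
\<close>

record ('o, 'm) cat =
  Obj :: "'o set"
  Hom :: "'o \<Rightarrow> 'o \<Rightarrow> 'm set"
  Ident :: "'o \<Rightarrow> 'm"
  Comp :: "'o \<Rightarrow> 'o \<Rightarrow> 'o \<Rightarrow> 'm \<Rightarrow> 'm \<Rightarrow> 'm"

locale category =
  fixes C :: "('o, 'm) cat"
  assumes ident_closed: "x \<in> Obj C \<Longrightarrow> Ident C x \<in> Hom C x x"
    and comp_closed: "\<lbrakk>x \<in> Obj C; y \<in> Obj C; z \<in> Obj C; f \<in> Hom C x y; g \<in> Hom C y z\<rbrakk>
      \<Longrightarrow> Comp C x y z g f \<in> Hom C x z"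
    and comp_ident_right: "\<lbrakk>x \<in> Obj C; y \<in> Obj C; f \<in> Hom C x y\<rbrakk>
      \<Longrightarrow> Comp C x x y f (Ident C x) = f"
    and comp_ident_left: "\<lbrakk>x \<in> Obj C; y \<in> Obj C; f \<in> Hom C x y\<rbrakk>
      \<Longrightarrow> Comp C x y y (Ident C y) f = f"
    and comp_assoc: "\<lbrakk>w \<in> Obj C; x \<in> Obj C; y \<in> Obj C; z \<in> Obj C;
        f \<in> Hom C w x; g \<in> Hom C x y; h \<in> Hom C y z\<rbrakk>
      \<Longrightarrow> Comp C w x z (Comp C x y z h g) f = Comp C w y z h (Comp C w x y g f)"

definition is_isomorphism :: "('o, 'm) cat \<Rightarrow> 'o \<Rightarrow> 'o \<Rightarrow> 'm \<Rightarrow> bool" where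
  "is_isomorphism C x y f \<longleftrightarrow> f \<in> Hom C x y \<and>
    (\<exists>g \<in> Hom C y x. Comp C x y x g f = Ident C x \<and> Comp C y x y f g = Ident C y)"

locale cat_functor =
  C: category C + D: category D
  for C :: "('o, 'm) cat" and D :: "('p, 'n) cat" +
  fixes Fo :: "'o \<Rightarrow> 'p" and Fm :: "'o \<Rightarrow> 'o \<Rightarrow> 'm \<Rightarrow> 'n"
  assumes obj_closed: "x \<in> Obj C \<Longrightarrow> Fo x \<in> Obj D"
    and hom_closed: "\<lbrakk>x \<in> Obj C; y \<in> Obj C; f \<in> Hom C x y\<rbrakk> \<Longrightarrow> Fm x y f \<in> Hom D (Fo x) (Fo y)"
    and map_ident: "x \<in> Obj C \<Longrightarrow> Fm x x (Ident C x) = Ident D (Fo x)"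
    and map_comp: "\<lbrakk>x \<in> Obj C; y \<in> Obj C; z \<in> Obj C; f \<in> Hom C x y; g \<in> Hom C y z\<rbrakk>
      \<Longrightarrow> Fm x z (Comp C x y z g f) = Comp D (Fo x) (Fo y) (Fo z) (Fm y z g) (Fm x y f)"

locale natural_isomorphism =
  F: cat_functor C D Fo Fm + G: cat_functor C D Go Gm
  for C :: "('o, 'm) cat" and D :: "('p, 'n) cat" and Fo Fm Go Gm +
  fixes \<eta> :: "'o \<Rightarrow> 'n"
  assumes component_iso: "x \<in> Obj C \<Longrightarrow> is_isomorphism D (Fo x) (Go x) (\<eta> x)"
    and naturality: "\<lbrakk>x \<in> Obj C; y \<in> Obj C; f \<in> Hom C x y\<rbrakk>
      \<Longrightarrow> Comp D (Fo x) (Fo y) (Go y) (\<eta> y) (Fm x y f)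
        = Comp D (Fo x) (Go x) (Go y) (Gm x y f) (\<eta> x)"

locale equivalence_of_categories =
  F: cat_functor C D Fo Fm +
  G: cat_functor D C Go Gm +
  unit: natural_isomorphism C C "\<lambda>x. x" "\<lambda>x y f. f"
    "\<lambda>x. Go (Fo x)" "\<lambda>x y f. Gm (Fo x) (Fo y) (Fm x y f)" \<eta> +
  counit: natural_isomorphism D D
    "\<lambda>x. Fo (Go x)" "\<lambda>x y f. Fm (Go x) (Go y) (Gm x y f)" "\<lambda>x. x" "\<lambda>x y f. f" \<epsilon>
  for C :: "('o, 'm) cat" and D :: "('p, 'n) cat" and Fo Fm Go Gm \<eta> \<epsilon>

definition equivalent_categories :: "('o, 'm) cat \<Rightarrow> ('p, 'n) cat \<Rightarrow> bool" where
  "equivalent_categories C D \<longleftrightarrow>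
    (\<exists>Fo Fm Go Gm \<eta> \<epsilon>. equivalence_of_categories C D Fo Fm Go Gm \<eta> \<epsilon>)"


section \<open>Internal reflexive graphs\<close>

record ('o, 'm) refl_graph =
  rg_X1 :: 'o
  rg_X0 :: 'o
  rg_d :: 'm
  rg_c :: 'm
  rg_e :: 'm

locale reflexive_graph =
  fixes C :: "('o, 'm) cat" and X :: "('o, 'm) refl_graph"
  assumes X1_obj: "rg_X1 X \<in> Obj C"
    and X0_obj: "rg_X0 X \<in> Obj C"
    and d_hom: "rg_d X \<in> Hom C (rg_X1 X) (rg_X0 X)"
    and c_hom: "rg_c X \<in> Hom C (rg_X1 X) (rg_X0 X)"
    and e_hom: "rg_e X \<in> Hom C (rg_X0 X) (rg_X1 X)"
    and d_e: "Comp C (rg_X0 X) (rg_X1 X) (rg_X0 X) (rg_d X) (rg_e X) = Ident C (rg_X0 X)"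
    and c_e: "Comp C (rg_X0 X) (rg_X1 X) (rg_X0 X) (rg_c X) (rg_e X) = Ident C (rg_X0 X)"

definition refl_graph_hom ::
  "('o, 'm) cat \<Rightarrow> ('o, 'm) refl_graph \<Rightarrow> ('o, 'm) refl_graph \<Rightarrow> ('m \<times> 'm) set" where
  "refl_graph_hom C X Y = {(f0, f1).
    f0 \<in> Hom C (rg_X0 X) (rg_X0 Y) \<and> f1 \<in> Hom C (rg_X1 X) (rg_X1 Y) \<and>
    Comp C (rg_X1 X) (rg_X1 Y) (rg_X0 Y) (rg_d Y) f1
      = Comp C (rg_X1 X) (rg_X0 X) (rg_X0 Y) f0 (rg_d X) \<and>
    Comp C (rg_X1 X) (rg_X1 Y) (rg_X0 Y) (rg_c Y) f1
      = Comp C (rg_X1 X) (rg_X0 X) (rg_X0 Y) f0 (rg_c X) \<and>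
    Comp C (rg_X0 X) (rg_X1 X) (rg_X1 Y) f1 (rg_e X)
      = Comp C (rg_X0 X) (rg_X0 Y) (rg_X1 Y) (rg_e Y) f0}"

definition RG :: "('o, 'm) cat \<Rightarrow> (('o, 'm) refl_graph, 'm \<times> 'm) cat" where
  "RG C = \<lparr>
    Obj = {X. reflexive_graph C X},
    Hom = refl_graph_hom C,
    Ident = (\<lambda>X. (Ident C (rg_X0 X), Ident C (rg_X1 X))),
    Comp = (\<lambda>X Y Z g f.
      (Comp C (rg_X0 X) (rg_X0 Y) (rg_X0 Z) (fst g) (fst f),
       Comp C (rg_X1 X) (rg_X1 Y) (rg_X1 Z) (snd g) (snd f)))\<rparr>"


section \<open>Right-preordered groups\<close>

text \<open>
  Groups are written multiplicatively, as in \<open>HOL-Algebra\<close>.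
\<close>

record 'a rpogroup = "'a monoid" +
  cone :: "'a set"

locale right_preordered_group =
  group G + cone: submonoid "cone G" G
  for G :: "'a rpogroup" (structure)

text \<open>
  Morphisms are extensional functions, so that equality of morphisms is equality on the carrier.
\<close>

definition rpo_hom :: "'a rpogroup \<Rightarrow> 'b rpogroup \<Rightarrow> ('a \<Rightarrow> 'b) set" where
  "rpo_hom G H = {f \<in> extensional (carrier G). f \<in> hom G H \<and> f ` cone G \<subseteq> cone H}"

text \<open>
  The type \<open>'a\<close> is the universe: objects are the right-preordered groups with carrier in \<open>'a\<close>.
  If it is infinite, the category contains, up to isomorphism, the (semi)direct products of its
  objects.
\<close>

definition RPOGrp :: "('a rpogroup, 'a \<Rightarrow> 'a) cat" where
  "RPOGrp = \<lparr>
    Obj = {G. right_preordered_group G},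
    Hom = rpo_hom,
    Ident = (\<lambda>G. \<lambda>x \<in> carrier G. x),
    Comp = (\<lambda>G H K g f. compose (carrier G) g f)\<rparr>"

definition rpo_Aut :: "'a rpogroup \<Rightarrow> ('a \<Rightarrow> 'a) rpogroup" where
  "rpo_Aut K = \<lparr>
    carrier = carrier (AutoGroup K),
    mult = mult (AutoGroup K),
    one = one (AutoGroup K),
    cone = {f \<in> carrier (AutoGroup K). f ` cone K \<subseteq> cone K}\<rparr>"

lemma right_preordered_group_rpo_Aut:
  assumes "right_preordered_group K"
  shows "right_preordered_group (rpo_Aut K)"
proof -
  interpret right_preordered_group K by fact
  have "group (AutoGroup K)" by (rule AutoGroup)
  then have grp: "group (rpo_Aut K)"
    unfolding group_def monoid_def group_axioms_def Units_def by (simp add: rpo_Aut_def)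
  moreover have "submonoid (cone (rpo_Aut K)) (rpo_Aut K)"
  proof
    show "cone (rpo_Aut K) \<subseteq> carrier (rpo_Aut K)"
      by (auto simp: rpo_Aut_def)
    show "\<one>\<^bsub>rpo_Aut K\<^esub> \<in> cone (rpo_Aut K)"
      using group.is_monoid[OF grp, THEN monoid.one_closed]
      by (auto simp: rpo_Aut_def AutoGroup_def BijGroup_def)
    fix f g assume f: "f \<in> cone (rpo_Aut K)" and g: "g \<in> cone (rpo_Aut K)"
    then have "f \<otimes>\<^bsub>rpo_Aut K\<^esub> g \<in> carrier (rpo_Aut K)"
      by (intro monoid.m_closed[OF group.is_monoid[OF grp]]) (auto simp: rpo_Aut_def)
    moreover have "f \<otimes>\<^bsub>rpo_Aut K\<^esub> g = compose (carrier K) f g"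
      using f g by (auto simp: rpo_Aut_def AutoGroup_def BijGroup_def auto_def)
    ultimately show "f \<otimes>\<^bsub>rpo_Aut K\<^esub> g \<in> cone (rpo_Aut K)"
      using f g by (auto simp: rpo_Aut_def compose_def image_subset_iff)
  qed
  ultimately show ?thesis by (simp add: right_preordered_group_def)
qed


section \<open>Schreier reflexive graphs\<close>

definition schreier_split_epi ::
  "'a rpogroup \<Rightarrow> 'a rpogroup \<Rightarrow> ('a \<Rightarrow> 'a) \<Rightarrow> ('a \<Rightarrow> 'a) \<Rightarrow> bool" where
  "schreier_split_epi X1 X0 d e \<longleftrightarrow>
    d \<in> Hom RPOGrp X1 X0 \<and> e \<in> Hom RPOGrp X0 X1 \<and>
    Comp RPOGrp X0 X1 X0 d e = Ident RPOGrp X0 \<and>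
    (\<forall>a \<in> cone X1. a \<otimes>\<^bsub>X1\<^esub> inv\<^bsub>X1\<^esub> (e (d a)) \<in> cone X1)"

definition SchRG ::
  "(('a rpogroup, 'a \<Rightarrow> 'a) refl_graph, ('a \<Rightarrow> 'a) \<times> ('a \<Rightarrow> 'a)) cat" where
  "SchRG = (RG RPOGrp)\<lparr>
    Obj := {X \<in> Obj (RG RPOGrp). schreier_split_epi (rg_X1 X) (rg_X0 X) (rg_d X) (rg_e X)}\<rparr>"


section \<open>Precrossed modules of right-preordered groups\<close>

record 'a precrossed =
  px_X1 :: "'a rpogroup"
  px_X0 :: "'a rpogroup"
  px_bd :: "'a \<Rightarrow> 'a"
  px_act :: "'a \<Rightarrow> 'a \<Rightarrow> 'a"

locale S_precrossed_module =
  fixes M :: "'a precrossed"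
  assumes X1: "right_preordered_group (px_X1 M)"
    and X0: "right_preordered_group (px_X0 M)"
    and bd_hom: "px_bd M \<in> rpo_hom (px_X1 M) (px_X0 M)"
    and act_hom: "px_act M \<in> rpo_hom (px_X0 M) (rpo_Aut (px_X1 M))"
    and precrossed: "\<lbrakk>a \<in> carrier (px_X1 M); x \<in> carrier (px_X0 M)\<rbrakk>
      \<Longrightarrow> px_bd M (px_act M x a)
        = x \<otimes>\<^bsub>px_X0 M\<^esub> px_bd M a \<otimes>\<^bsub>px_X0 M\<^esub> inv\<^bsub>px_X0 M\<^esub> x"

definition precrossed_hom ::
  "'a precrossed \<Rightarrow> 'a precrossed \<Rightarrow> (('a \<Rightarrow> 'a) \<times> ('a \<Rightarrow> 'a)) set" where
  "precrossed_hom M N = {(g0, g1).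
    g0 \<in> rpo_hom (px_X0 M) (px_X0 N) \<and> g1 \<in> rpo_hom (px_X1 M) (px_X1 N) \<and>
    (\<forall>a \<in> carrier (px_X1 M). g0 (px_bd M a) = px_bd N (g1 a)) \<and>
    (\<forall>x \<in> carrier (px_X0 M). \<forall>a \<in> carrier (px_X1 M).
      g1 (px_act M x a) = px_act N (g0 x) (g1 a))}"

definition S_PXMod :: "('a precrossed, ('a \<Rightarrow> 'a) \<times> ('a \<Rightarrow> 'a)) cat" where
  "S_PXMod = \<lparr>
    Obj = {M. S_precrossed_module M},
    Hom = precrossed_hom,
    Ident = (\<lambda>M. (\<lambda>x \<in> carrier (px_X0 M). x, \<lambda>a \<in> carrier (px_X1 M). a)),
    Comp = (\<lambda>L M N g f.
      (compose (carrier (px_X0 L)) (fst g) (fst f),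
       compose (carrier (px_X1 L)) (snd g) (snd f)))\<rparr>"

end

(*
  A Schreier split epimorphism (d, e) decomposes a = (a - e (d a)) + e (d a), and the Schreier
  condition says exactly that the kernel part of a positive element is positive; so the object of
  arrows is the semidirect product, with the product cone, of the kernel of d and the object of
  objects acting on it by conjugation with e. Taking the kernel is therefore a fully faithful
  functor to precrossed modules. It is essentially surjective because the semidirect product of a
  precrossed module is a Schreier reflexive graph whose kernel is the module itself; an injection
  from pairs into the infinite universe keeps the carrier of this product inside the universe.
*)

theory Submission
  imports Defs
begin

section \<open>Fully faithful, essentially surjective functors\<close>

lemma is_isomorphismI:
  assumes "f \<in> Hom C x y" "g \<in> Hom C y x"
    "Comp C x y x g f = Ident C x" "Comp C y x y f g = Ident C y"
  shows "is_isomorphism C x y f"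
  using assms by (auto simp: is_isomorphism_def)

text \<open>As a rewrite rule, this removes a pair \<open>h\<close>, \<open>g\<close> at the front
  of a right-nested composite, where \<open>comp_assoc\<close> and the plain equation
  \<open>h g = id\<close> do not meet.\<close>

lemma (in category) Comp_left_cancel:
  assumes "w \<in> Obj C" "x \<in> Obj C" "y \<in> Obj C" "f \<in> Hom C w x" "g \<in> Hom C x y" "h \<in> Hom C y x"
    "Comp C x y x h g = Ident C x"
  shows "Comp C w y x h (Comp C w x y g f) = f"
  using assms comp_assoc[of w x y x f g h] comp_ident_left[of w x f] by simp

lemma (in category) cat_functor_id: "cat_functor C C (\<lambda>x. x) (\<lambda>x y f. f)"
  by unfold_locales auto

lemma cat_functor_compose:
  assumes "cat_functor C D Fo Fm" "cat_functor D E Go Gm"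
  shows "cat_functor C E (\<lambda>x. Go (Fo x)) (\<lambda>x y f. Gm (Fo x) (Fo y) (Fm x y f))"
proof -
  interpret F: cat_functor C D Fo Fm by fact
  interpret G: cat_functor D E Go Gm by fact
  show ?thesis
    by unfold_locales
      (simp_all add: F.obj_closed F.hom_closed F.map_ident F.map_comp
        G.obj_closed G.hom_closed G.map_ident G.map_comp)
qed

locale fully_faithful_functor = cat_functor +
  assumes bij_betw_hom: "\<lbrakk>x \<in> Obj C; y \<in> Obj C\<rbrakk>
    \<Longrightarrow> bij_betw (Fm x y) (Hom C x y) (Hom D (Fo x) (Fo y))"
begin

definition lift :: "'a \<Rightarrow> 'a \<Rightarrow> 'd \<Rightarrow> 'b" where
  "lift x y = inv_into (Hom C x y) (Fm x y)"

lemma lift_hom: "\<lbrakk>x \<in> Obj C; y \<in> Obj C; h \<in> Hom D (Fo x) (Fo y)\<rbrakk> \<Longrightarrow> lift x y h \<in> Hom C x y"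
  using bij_betw_hom[of x y] unfolding lift_def by (metis bij_betw_imp_surj_on inv_into_into)

lemma map_lift: "\<lbrakk>x \<in> Obj C; y \<in> Obj C; h \<in> Hom D (Fo x) (Fo y)\<rbrakk> \<Longrightarrow> Fm x y (lift x y h) = h"
  using bij_betw_hom[of x y] unfolding lift_def by (metis bij_betw_inv_into_right)

lemma faithful:
  "\<lbrakk>x \<in> Obj C; y \<in> Obj C; f \<in> Hom C x y; g \<in> Hom C x y; Fm x y f = Fm x y g\<rbrakk> \<Longrightarrow> f = g"
  using bij_betw_hom[of x y] by (metis bij_betw_imp_inj_on inj_onD)

text \<open>The inverse \<open>k\<close> is lifted as well. Both inverse laws hold after applying
  \<open>Fm\<close>, so faithfulness gives them in \<open>C\<close>.\<close>

lemma is_isomorphism_lift: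
  assumes x: "x \<in> Obj C" and y: "y \<in> Obj C" and h: "is_isomorphism D (Fo x) (Fo y) h"
  shows "is_isomorphism C x y (lift x y h)"
proof -
  obtain k where k: "k \<in> Hom D (Fo y) (Fo x)" "h \<in> Hom D (Fo x) (Fo y)"
    "Comp D (Fo x) (Fo y) (Fo x) k h = Ident D (Fo x)"
    "Comp D (Fo y) (Fo x) (Fo y) h k = Ident D (Fo y)"
    using h unfolding is_isomorphism_def by blast
  note [simp] = x y k lift_hom map_lift map_comp map_ident C.comp_closed C.ident_closed
  show ?thesis
  proof (rule is_isomorphismI[where g = "lift y x k"])
    show "Comp C x y x (lift y x k) (lift x y h) = Ident C x"
      by (rule faithful[of x x]) simp_all
    show "Comp C y x y (lift x y h) (lift y x k) = Ident C y"
      by (rule faithful[of y y]) simp_all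
  qed simp_all
qed

theorem equivalent_if_essentially_surjective:
  assumes ess_surj: "\<And>d. d \<in> Obj D \<Longrightarrow> \<exists>x\<in>Obj C. \<exists>f. is_isomorphism D (Fo x) d f"
  shows "equivalent_categories C D"
proof -
  \<comment> \<open>The inverse of each isomorphism is exposed, so that a single choice yields
    \<open>Go\<close>, the counit \<open>\<epsilon>\<close> and its inverse
    \<open>\<epsilon>'\<close>.\<close>
  have "\<forall>d\<in>Obj D. \<exists>x f g. x \<in> Obj C \<and> f \<in> Hom D (Fo x) d \<and> g \<in> Hom D d (Fo x) \<and>
      Comp D (Fo x) d (Fo x) g f = Ident D (Fo x) \<and> Comp D d (Fo x) d f g = Ident D d"
    using ess_surj unfolding is_isomorphism_def by blast
  then obtain Go \<epsilon> \<epsilon>' where G: "\<And>d. d \<in> Obj D \<Longrightarrow> Go d \<in> Obj C"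
    and \<epsilon>: "\<And>d. d \<in> Obj D \<Longrightarrow> \<epsilon> d \<in> Hom D (Fo (Go d)) d"
    and \<epsilon>': "\<And>d. d \<in> Obj D \<Longrightarrow> \<epsilon>' d \<in> Hom D d (Fo (Go d))"
    and \<epsilon>'_\<epsilon>: "\<And>d. d \<in> Obj D \<Longrightarrow> Comp D (Fo (Go d)) d (Fo (Go d)) (\<epsilon>' d) (\<epsilon> d) = Ident D (Fo (Go d))"
    and \<epsilon>_\<epsilon>': "\<And>d. d \<in> Obj D \<Longrightarrow> Comp D d (Fo (Go d)) d (\<epsilon> d) (\<epsilon>' d) = Ident D d"
    by metis
  note [simp] = G \<epsilon> \<epsilon>' \<epsilon>'_\<epsilon> \<epsilon>_\<epsilon>' obj_closed hom_closed map_comp map_ident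
    C.comp_closed C.ident_closed D.comp_closed D.ident_closed
    D.comp_ident_left D.comp_ident_right D.Comp_left_cancel lift_hom map_lift
  \<comment> \<open>Naturality of \<open>\<epsilon>\<close> forces the image under \<open>Fm\<close>
    of \<open>Gm a b f\<close> to be \<open>f\<close> conjugated by the chosen isomorphisms;
    fullness then lifts it to \<open>C\<close>.\<close>
  define conj where "conj = (\<lambda>a b f. Comp D (Fo (Go a)) b (Fo (Go b)) (\<epsilon>' b)
    (Comp D (Fo (Go a)) a b f (\<epsilon> a)))"
  define Gm where "Gm = (\<lambda>a b f. lift (Go a) (Go b) (conj a b f))"
  \<comment> \<open>One triangle identity dictates the unit: its image under \<open>Fm\<close> must
    be inverse to the counit at \<open>Fo x\<close>.\<close>
  define \<eta> where "\<eta> = (\<lambda>x. lift x (Go (Fo x)) (\<epsilon>' (Fo x)))"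
  have conj_hom [simp]: "conj a b f \<in> Hom D (Fo (Go a)) (Fo (Go b))"
    if "a \<in> Obj D" "b \<in> Obj D" "f \<in> Hom D a b" for a b f
    using that by (simp add: conj_def)
  have conj_Ident: "conj a a (Ident D a) = Ident D (Fo (Go a))" if "a \<in> Obj D" for a
    using that by (simp add: conj_def)
  have conj_Comp: "conj a c (Comp D a b c g f)
      = Comp D (Fo (Go a)) (Fo (Go b)) (Fo (Go c)) (conj b c g) (conj a b f)"
    if "a \<in> Obj D" "b \<in> Obj D" "c \<in> Obj D" "f \<in> Hom D a b" "g \<in> Hom D b c" for a b c f g
    using that by (simp add: conj_def D.comp_assoc)
  \<comment> \<open>The functor laws hold for \<open>conj\<close> in \<open>D\<close>, and
    faithfulness reflects them to \<open>Gm\<close>.\<close>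
  have G_functor: "cat_functor D C Go Gm"
  proof unfold_locales
    fix a assume a: "a \<in> Obj D"
    then show "Gm a a (Ident D a) = Ident C (Go a)"
      by (intro faithful[of "Go a" "Go a"]) (simp_all add: Gm_def conj_Ident)
  next
    fix a b c f g assume "a \<in> Obj D" "b \<in> Obj D" "c \<in> Obj D" "f \<in> Hom D a b" "g \<in> Hom D b c"
    then show "Gm a c (Comp D a b c g f) = Comp C (Go a) (Go b) (Go c) (Gm b c g) (Gm a b f)"
      by (intro faithful[of "Go a" "Go c"]) (simp_all add: Gm_def conj_Comp)
  qed (simp_all add: Gm_def)
  have "equivalence_of_categories C D Fo Fm Go Gm \<eta> \<epsilon>"
  proof (intro equivalence_of_categories.intro natural_isomorphism.intro
      natural_isomorphism_axioms.intro)
    show "cat_functor C D Fo Fm" by (rule cat_functor_axioms)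
    show "cat_functor D C Go Gm" by fact
    show "cat_functor C C (\<lambda>x. x) (\<lambda>x y f. f)" by (rule C.cat_functor_id)
    show "cat_functor D D (\<lambda>x. x) (\<lambda>x y f. f)" by (rule D.cat_functor_id)
    show "cat_functor C C (\<lambda>x. Go (Fo x)) (\<lambda>x y f. Gm (Fo x) (Fo y) (Fm x y f))"
      by (rule cat_functor_compose[OF cat_functor_axioms G_functor])
    show "cat_functor D D (\<lambda>x. Fo (Go x)) (\<lambda>x y f. Fm (Go x) (Go y) (Gm x y f))"
      by (rule cat_functor_compose[OF G_functor cat_functor_axioms])
  next
    fix d assume "d \<in> Obj D"
    then show "is_isomorphism D (Fo (Go d)) d (\<epsilon> d)"
      by (intro is_isomorphismI[where g = "\<epsilon>' d"]) simp_all
  next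
    fix a b f assume "a \<in> Obj D" "b \<in> Obj D" "f \<in> Hom D a b"
    then show "Comp D (Fo (Go a)) (Fo (Go b)) b (\<epsilon> b) (Fm (Go a) (Go b) (Gm a b f))
        = Comp D (Fo (Go a)) a b f (\<epsilon> a)"
      by (simp add: Gm_def) (simp add: conj_def)
  next
    fix x assume "x \<in> Obj C"
    then show "is_isomorphism C x (Go (Fo x)) (\<eta> x)"
      unfolding \<eta>_def
      by (intro is_isomorphism_lift) (auto intro: is_isomorphismI[where g = "\<epsilon> (Fo x)"])
  next
    fix x y f assume "x \<in> Obj C" "y \<in> Obj C" "f \<in> Hom C x y"
    \<comment> \<open>After applying \<open>Fm\<close>, the factor \<open>\<epsilon> (Fo x)\<close>
      inside \<open>conj\<close> cancels against \<open>\<epsilon>' (Fo x)\<close>, and both sides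
      become \<open>\<epsilon>' (Fo y)\<close> after \<open>Fm x y f\<close>.\<close>
    then show "Comp C x y (Go (Fo y)) (\<eta> y) f
        = Comp C x (Go (Fo x)) (Go (Fo y)) (Gm (Fo x) (Fo y) (Fm x y f)) (\<eta> x)"
      by (intro faithful[of x "Go (Fo y)"]) (simp_all add: Gm_def \<eta>_def, simp add: conj_def D.comp_assoc)
  qed
  then show ?thesis unfolding equivalent_categories_def by blast
qed

end

section \<open>The categories involved\<close>

lemma category_RG:
  assumes "category C"
  shows "category (RG C)"
proof -
  interpret category C by fact
  note [simp] = reflexive_graph.X1_obj reflexive_graph.X0_obj reflexive_graph.d_hom
    reflexive_graph.c_hom reflexive_graph.e_hom ident_closed comp_closed comp_ident_left
    comp_ident_right
  show ?thesis
  proof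
    fix X Y Z f g
    assume "X \<in> Obj (RG C)" "Y \<in> Obj (RG C)" "Z \<in> Obj (RG C)"
      "f \<in> Hom (RG C) X Y" "g \<in> Hom (RG C) Y Z"
    moreover obtain f0 f1 g0 g1 where "f = (f0, f1)" "g = (g0, g1)" by fastforce
    ultimately have X: "reflexive_graph C X" and Y: "reflexive_graph C Y" and Z: "reflexive_graph C Z"
      and f: "(f0, f1) \<in> refl_graph_hom C X Y" and g: "(g0, g1) \<in> refl_graph_hom C Y Z"
      and eqs: "f = (f0, f1)" "g = (g0, g1)"
      by (simp_all add: RG_def)
    \<comment> \<open>Pasting of two commuting squares. It serves for \<open>d\<close>, for
      \<open>c\<close>, and, with the two levels exchanged and the equation reversed, for
      \<open>e\<close>.\<close>
    have square: "Comp C x1 z1 z0 r (Comp C x1 y1 z1 g' f') = Comp C x1 x0 z0 (Comp C x0 y0 z0 g'' f'') p"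
      if "x1 \<in> Obj C" "x0 \<in> Obj C" "y1 \<in> Obj C" "y0 \<in> Obj C" "z1 \<in> Obj C" "z0 \<in> Obj C"
        "p \<in> Hom C x1 x0" "q \<in> Hom C y1 y0" "r \<in> Hom C z1 z0"
        "f' \<in> Hom C x1 y1" "f'' \<in> Hom C x0 y0" "g' \<in> Hom C y1 z1" "g'' \<in> Hom C y0 z0"
        "Comp C x1 y1 y0 q f' = Comp C x1 x0 y0 f'' p"
        "Comp C y1 z1 z0 r g' = Comp C y1 y0 z0 g'' q"
      for x1 x0 y1 y0 z1 z0 p q r f' f'' g' g''
    proof -
      have "Comp C x1 z1 z0 r (Comp C x1 y1 z1 g' f') = Comp C x1 y1 z0 (Comp C y1 z1 z0 r g') f'"
        using that(1-13) by (simp add: comp_assoc)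
      also have "\<dots> = Comp C x1 y0 z0 g'' (Comp C x1 y1 y0 q f')"
        unfolding that(15) using that(1-13) by (simp add: comp_assoc)
      also have "\<dots> = Comp C x1 x0 z0 (Comp C x0 y0 z0 g'' f'') p"
        unfolding that(14) using that(1-13) by (simp add: comp_assoc)
      finally show ?thesis .
    qed
    show "Comp (RG C) X Y Z g f \<in> Hom (RG C) X Z"
      using f g X Y Z unfolding eqs RG_def refl_graph_hom_def
      apply (simp, intro conjI)
        apply (rule square[of _ _ "rg_X1 Y" "rg_X0 Y" _ _ _ "rg_d Y"]; simp)
       apply (rule square[of _ _ "rg_X1 Y" "rg_X0 Y" _ _ _ "rg_c Y"]; simp)
      apply (rule square[of _ _ "rg_X0 Y" "rg_X1 Y" _ _ _ "rg_e Y", symmetric]; simp)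
      done
  next
    fix W X Y Z f g h
    assume "W \<in> Obj (RG C)" "X \<in> Obj (RG C)" "Y \<in> Obj (RG C)" "Z \<in> Obj (RG C)"
      "f \<in> Hom (RG C) W X" "g \<in> Hom (RG C) X Y" "h \<in> Hom (RG C) Y Z"
    then show "Comp (RG C) W X Z (Comp (RG C) X Y Z h g) f
        = Comp (RG C) W Y Z h (Comp (RG C) W X Y g f)"
      by (auto simp: RG_def refl_graph_hom_def comp_assoc)
  qed (auto simp: RG_def refl_graph_hom_def)
qed

section \<open>Homomorphisms of right-preordered groups\<close>

lemma rpo_homD:
  assumes "f \<in> rpo_hom G H"
  shows "f \<in> hom G H" "f \<in> extensional (carrier G)"
    "x \<in> carrier G \<Longrightarrow> f x \<in> carrier H" "x \<in> cone G \<Longrightarrow> f x \<in> cone H"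
    "\<lbrakk>x \<in> carrier G; y \<in> carrier G\<rbrakk> \<Longrightarrow> f (x \<otimes>\<^bsub>G\<^esub> y) = f x \<otimes>\<^bsub>H\<^esub> f y"
  using assms by (auto simp: rpo_hom_def hom_def)

lemma rpo_hom_group:
  assumes "right_preordered_group G" "right_preordered_group H" "f \<in> rpo_hom G H"
  shows "f \<one>\<^bsub>G\<^esub> = \<one>\<^bsub>H\<^esub>" "x \<in> carrier G \<Longrightarrow> f (inv\<^bsub>G\<^esub> x) = inv\<^bsub>H\<^esub> f x"
proof -
  interpret group_hom G H f
    using assms by (simp add: group_hom_def group_hom_axioms_def right_preordered_group_def rpo_homD)
  show "f \<one>\<^bsub>G\<^esub> = \<one>\<^bsub>H\<^esub>" "x \<in> carrier G \<Longrightarrow> f (inv\<^bsub>G\<^esub> x) = inv\<^bsub>H\<^esub> f x"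
    by simp_all
qed

lemma (in right_preordered_group) cone_carrier: "x \<in> cone G \<Longrightarrow> x \<in> carrier G"
  by (rule cone.mem_carrier)

lemma rpo_hom_ident:
  assumes "right_preordered_group G"
  shows "(\<lambda>x\<in>carrier G. x) \<in> rpo_hom G G"
proof -
  interpret right_preordered_group G by fact
  show ?thesis by (auto simp: rpo_hom_def hom_def cone_carrier)
qed

lemma rpo_hom_compose:
  assumes "right_preordered_group G" "f \<in> rpo_hom G H" "g \<in> rpo_hom H K"
  shows "compose (carrier G) g f \<in> rpo_hom G K"
proof -
  interpret right_preordered_group G by fact
  show ?thesis
    using assms(2,3) by (auto simp: rpo_hom_def hom_def compose_def cone_carrier image_subset_iff Pi_iff)
qed

lemma rpo_hom_compose_ident:
  assumes "f \<in> rpo_hom G H"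
  shows "compose (carrier G) f (\<lambda>x\<in>carrier G. x) = f"
    "compose (carrier G) (\<lambda>x\<in>carrier H. x) f = f"
  using rpo_homD(2,3)[OF assms] by (auto simp: compose_def fun_eq_iff extensional_def)

lemma rpo_hom_compose_assoc:
  assumes "f \<in> rpo_hom G H"
  shows "compose (carrier G) (compose (carrier H) h g) f
    = compose (carrier G) h (compose (carrier G) g f)"
  using rpo_homD(3)[OF assms] by (auto simp: compose_def fun_eq_iff)

lemma category_RPOGrp: "category (RPOGrp :: ('a rpogroup, 'a \<Rightarrow> 'a) cat)"
  by unfold_locales
    (auto simp: RPOGrp_def rpo_hom_ident rpo_hom_compose rpo_hom_compose_ident rpo_hom_compose_assoc)

lemma category_SchRG: "category (SchRG :: (('a rpogroup, 'a \<Rightarrow> 'a) refl_graph, ('a \<Rightarrow> 'a) \<times> ('a \<Rightarrow> 'a)) cat)"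
proof -
  interpret category "RG (RPOGrp :: ('a rpogroup, 'a \<Rightarrow> 'a) cat)"
    by (intro category_RG category_RPOGrp)
  show ?thesis
    by unfold_locales
      (auto simp: SchRG_def ident_closed comp_closed comp_ident_left comp_ident_right comp_assoc)
qed

lemma category_S_PXMod: "category (S_PXMod :: ('a precrossed, ('a \<Rightarrow> 'a) \<times> ('a \<Rightarrow> 'a)) cat)"
proof -
  note [simp] = S_precrossed_module.X1 S_precrossed_module.X0
  \<comment> \<open>Equivariance of a composite evaluates \<open>compose\<close> at
    \<open>px_act M x a\<close>, which is meaningful only inside the carrier.\<close>
  have act: "px_act M x a \<in> carrier (px_X1 M)"
    if "S_precrossed_module M" "x \<in> carrier (px_X0 M)" "a \<in> carrier (px_X1 M)"
    for M :: "'a precrossed" and x a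
    using rpo_homD(3)[OF S_precrossed_module.act_hom[OF that(1)] that(2)] that(3)
    by (auto simp: rpo_Aut_def AutoGroup_def auto_def hom_def)
  note bd = rpo_homD(3)[OF S_precrossed_module.bd_hom]
  show ?thesis
  proof
    fix X Y Z f g
    assume *: "X \<in> Obj S_PXMod" "Y \<in> Obj S_PXMod" "Z \<in> Obj S_PXMod"
      "f \<in> Hom S_PXMod X Y" "g \<in> Hom (S_PXMod :: ('a precrossed, ('a \<Rightarrow> 'a) \<times> ('a \<Rightarrow> 'a)) cat) Y Z"
    then show "Comp S_PXMod X Y Z g f \<in> Hom S_PXMod X Z"
      by (auto simp: S_PXMod_def precrossed_hom_def rpo_hom_compose compose_eq act bd rpo_homD)
  qed (auto simp: S_PXMod_def precrossed_hom_def rpo_hom_ident rpo_hom_compose_ident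
      rpo_hom_compose_assoc act bd)
qed

section \<open>The kernel of a Schreier reflexive graph\<close>

text \<open>A reflexive graph already contains the split epimorphism, so only positivity of the
  kernel parts is left of the Schreier condition.\<close>

lemma Obj_SchRG:
  "X \<in> Obj SchRG \<longleftrightarrow> reflexive_graph RPOGrp X \<and>
    (\<forall>a \<in> cone (rg_X1 X). a \<otimes>\<^bsub>rg_X1 X\<^esub> inv\<^bsub>rg_X1 X\<^esub> (rg_e X (rg_d X a)) \<in> cone (rg_X1 X))"
  by (auto simp: SchRG_def RG_def schreier_split_epi_def reflexive_graph_def)

locale schreier_graph =
  fixes X :: "('a rpogroup, 'a \<Rightarrow> 'a) refl_graph"
  assumes obj: "X \<in> Obj SchRG"
begin

abbreviation "A \<equiv> rg_X1 X"
abbreviation "B \<equiv> rg_X0 X"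
abbreviation "d \<equiv> rg_d X"
abbreviation "c \<equiv> rg_c X"
abbreviation "e \<equiv> rg_e X"

lemma graph: "reflexive_graph RPOGrp X"
  using obj by (simp add: Obj_SchRG)

lemma rpo_A: "right_preordered_group A" and rpo_B: "right_preordered_group B"
  using reflexive_graph.X1_obj[OF graph] reflexive_graph.X0_obj[OF graph]
  by (simp_all add: RPOGrp_def)

sublocale A: right_preordered_group A by (rule rpo_A)
sublocale B: right_preordered_group B by (rule rpo_B)

lemma d_hom: "d \<in> rpo_hom A B" and c_hom: "c \<in> rpo_hom A B" and e_hom: "e \<in> rpo_hom B A"
  using reflexive_graph.d_hom[OF graph] reflexive_graph.c_hom[OF graph]
    reflexive_graph.e_hom[OF graph]
  by (simp_all add: RPOGrp_def)

lemmas hom_simps [simp] =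
  d_hom[THEN rpo_homD(3)] c_hom[THEN rpo_homD(3)] e_hom[THEN rpo_homD(3)]
  d_hom[THEN rpo_homD(4)] c_hom[THEN rpo_homD(4)] e_hom[THEN rpo_homD(4)]
  d_hom[THEN rpo_homD(5)] c_hom[THEN rpo_homD(5)] e_hom[THEN rpo_homD(5)]
  rpo_hom_group[OF rpo_A rpo_B d_hom] rpo_hom_group[OF rpo_A rpo_B c_hom]
  rpo_hom_group[OF rpo_B rpo_A e_hom]

lemma d_e [simp]: "x \<in> carrier B \<Longrightarrow> d (e x) = x"
  using reflexive_graph.d_e[OF graph] by (auto simp: RPOGrp_def compose_def fun_eq_iff split: if_splits)

lemma c_e [simp]: "x \<in> carrier B \<Longrightarrow> c (e x) = x"
  using reflexive_graph.c_e[OF graph] by (auto simp: RPOGrp_def compose_def fun_eq_iff split: if_splits)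

definition K :: "'a rpogroup" where
  "K = A\<lparr>carrier := {a \<in> carrier A. d a = \<one>\<^bsub>B\<^esub>},
    cone := {a \<in> cone A. d a = \<one>\<^bsub>B\<^esub>}\<rparr>"

lemma K_simps [simp]:
  "a \<in> carrier K \<longleftrightarrow> a \<in> carrier A \<and> d a = \<one>\<^bsub>B\<^esub>"
  "a \<in> cone K \<longleftrightarrow> a \<in> cone A \<and> d a = \<one>\<^bsub>B\<^esub>"
  "\<one>\<^bsub>K\<^esub> = \<one>\<^bsub>A\<^esub>" "a \<otimes>\<^bsub>K\<^esub> b = a \<otimes>\<^bsub>A\<^esub> b"
  by (auto simp: K_def)

lemma rpo_K: "right_preordered_group K"
proof -
  have "group K"
  proof (rule groupI)
    fix a assume "a \<in> carrier K"
    then show "\<exists>b\<in>carrier K. b \<otimes>\<^bsub>K\<^esub> a = \<one>\<^bsub>K\<^esub>"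
      by (intro bexI[of _ "inv\<^bsub>A\<^esub> a"]) auto
  qed (auto simp: A.m_assoc)
  moreover have "submonoid (cone K) K"
    by unfold_locales (auto simp: A.cone_carrier A.cone.m_closed)
  ultimately show ?thesis by (simp add: right_preordered_group_def)
qed

text \<open>Both abstractions are restricted: elements of \<open>rpo_Aut K\<close> are extensional
  on \<open>carrier K\<close>, and a morphism out of \<open>B\<close> is extensional on
  \<open>carrier B\<close>.\<close>

definition act :: "'a \<Rightarrow> 'a \<Rightarrow> 'a" where
  "act = (\<lambda>x\<in>carrier B. \<lambda>k\<in>carrier K. e x \<otimes>\<^bsub>A\<^esub> k \<otimes>\<^bsub>A\<^esub> inv\<^bsub>A\<^esub> (e x))"

lemma act_apply: "\<lbrakk>x \<in> carrier B; k \<in> carrier A; d k = \<one>\<^bsub>B\<^esub>\<rbrakk>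
    \<Longrightarrow> act x k = e x \<otimes>\<^bsub>A\<^esub> k \<otimes>\<^bsub>A\<^esub> inv\<^bsub>A\<^esub> (e x)"
  by (simp add: act_def)

lemma A_cancel [simp]:
  "\<lbrakk>x \<in> carrier A; y \<in> carrier A\<rbrakk> \<Longrightarrow> inv\<^bsub>A\<^esub> x \<otimes>\<^bsub>A\<^esub> (x \<otimes>\<^bsub>A\<^esub> y) = y"
  "\<lbrakk>x \<in> carrier A; y \<in> carrier A\<rbrakk> \<Longrightarrow> x \<otimes>\<^bsub>A\<^esub> (inv\<^bsub>A\<^esub> x \<otimes>\<^bsub>A\<^esub> y) = y"
  by (simp_all flip: A.m_assoc)

lemma schreier: "a \<in> cone A \<Longrightarrow> a \<otimes>\<^bsub>A\<^esub> inv\<^bsub>A\<^esub> (e (d a)) \<in> cone A"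
  using obj by (simp add: Obj_SchRG)

lemma act_hom: "act \<in> rpo_hom B (rpo_Aut K)"
proof -
  have closed: "act x k \<in> carrier K" if "x \<in> carrier B" "k \<in> carrier K" for x k
    using that by (simp add: act_apply)
  \<comment> \<open>Conjugation by \<open>e x\<close> is undone by conjugation by
    \<open>e (inv x)\<close>.\<close>
  have bij: "bij_betw (act x) (carrier K) (carrier K)" if "x \<in> carrier B" for x
    using that by (intro bij_betw_byWitness[where f' = "act (inv\<^bsub>B\<^esub> x)"])
      (auto simp: act_apply A.m_assoc)
  have auto: "act x \<in> auto K" if x: "x \<in> carrier B" for x
    using bij[OF x] x
    by (auto simp: auto_def Bij_def hom_def act_apply A.m_assoc) (simp add: act_def)
  have mult: "act (x \<otimes>\<^bsub>B\<^esub> y) = compose (carrier K) (act x) (act y)"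
    if "x \<in> carrier B" "y \<in> carrier B" for x y
  proof (rule extensionalityI)
    fix k assume "k \<in> carrier K"
    with that show "act (x \<otimes>\<^bsub>B\<^esub> y) k = compose (carrier K) (act x) (act y) k"
      by (simp add: compose_eq act_apply A.m_assoc A.inv_mult_group)
  qed (use that in \<open>auto simp: act_def\<close>)
  \<comment> \<open>The product of \<open>e x\<close> and \<open>k\<close> is positive and
    \<open>d\<close> sends it to \<open>x\<close>. Its Schreier kernel part is therefore exactly the
    conjugate \<open>act x k\<close>, which is positive although \<open>inv (e x)\<close> need not
    be.\<close>
  have pos: "act x k \<in> cone K" if x: "x \<in> cone B" and k: "k \<in> cone K" for x k
  proof -
    have "e x \<otimes>\<^bsub>A\<^esub> k \<in> cone A" using x k by (simp add: A.cone.m_closed)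
    from schreier[OF this] show ?thesis
      using x k by (simp add: act_apply A.cone_carrier B.cone_carrier)
  qed
  show ?thesis
    using auto mult pos closed
    by (auto simp: rpo_hom_def hom_def rpo_Aut_def AutoGroup_def BijGroup_def auto_def
        B.cone_carrier simp del: K_simps) (simp add: act_def)
qed

definition ker_precrossed :: "'a precrossed" where
  "ker_precrossed = \<lparr>px_X1 = K, px_X0 = B, px_bd = restrict c (carrier K), px_act = act\<rparr>"

lemma ker_precrossed_simps [simp]:
  "px_X1 ker_precrossed = K" "px_X0 ker_precrossed = B"
  "px_bd ker_precrossed = restrict c (carrier K)" "px_act ker_precrossed = act"
  by (simp_all add: ker_precrossed_def)

lemma ker_precrossed_Obj: "ker_precrossed \<in> Obj S_PXMod"
proof -
  have "S_precrossed_module ker_precrossed"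
  proof (rule S_precrossed_module.intro)
    show "px_bd ker_precrossed \<in> rpo_hom (px_X1 ker_precrossed) (px_X0 ker_precrossed)"
      by (auto simp: rpo_hom_def hom_def A.cone_carrier)
  qed (simp_all add: rpo_K rpo_B act_hom act_apply)
  then show ?thesis by (simp add: S_PXMod_def)
qed

definition kpart :: "'a \<Rightarrow> 'a" where "kpart a = a \<otimes>\<^bsub>A\<^esub> inv\<^bsub>A\<^esub> (e (d a))"

lemma kpart_simps [simp]:
  "a \<in> carrier A \<Longrightarrow> kpart a \<in> carrier A" "a \<in> carrier A \<Longrightarrow> d (kpart a) = \<one>\<^bsub>B\<^esub>"
  "a \<in> cone A \<Longrightarrow> kpart a \<in> cone A"
  "a \<in> carrier A \<Longrightarrow> kpart a \<otimes>\<^bsub>A\<^esub> e (d a) = a"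
  "x \<in> carrier B \<Longrightarrow> kpart (e x) = \<one>\<^bsub>A\<^esub>"
  "\<lbrakk>a \<in> carrier A; d a = \<one>\<^bsub>B\<^esub>\<rbrakk> \<Longrightarrow> kpart a = a"
  using schreier[of a] by (auto simp: kpart_def A.m_assoc)

text \<open>Moving \<open>e (d a)\<close> to the right past \<open>kpart b\<close> conjugates the
  latter. This is the first coordinate of the product in the semidirect product of \<open>K\<close>
  and \<open>B\<close>.\<close>

lemma kpart_mult: "\<lbrakk>a \<in> carrier A; b \<in> carrier A\<rbrakk>
    \<Longrightarrow> kpart (a \<otimes>\<^bsub>A\<^esub> b) = kpart a \<otimes>\<^bsub>A\<^esub> act (d a) (kpart b)"
  by (simp add: act_apply) (simp add: kpart_def A.m_assoc A.inv_mult_group)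

lemma c_kpart: "a \<in> carrier A \<Longrightarrow> c (kpart a) = c a \<otimes>\<^bsub>B\<^esub> inv\<^bsub>B\<^esub> (d a)"
  by (simp add: kpart_def)

end

section \<open>The kernel as a fully faithful functor\<close>

definition ker_map :: "('a rpogroup, 'a \<Rightarrow> 'a) refl_graph \<Rightarrow> ('a rpogroup, 'a \<Rightarrow> 'a) refl_graph
    \<Rightarrow> ('a \<Rightarrow> 'a) \<times> ('a \<Rightarrow> 'a) \<Rightarrow> ('a \<Rightarrow> 'a) \<times> ('a \<Rightarrow> 'a)" where
  "ker_map X Y f = (fst f, restrict (snd f) (carrier (schreier_graph.K X)))"

lemma Hom_SchRG:
  assumes "X \<in> Obj SchRG" "Y \<in> Obj SchRG"
  shows "(f0, f1) \<in> Hom SchRG X Y \<longleftrightarrow>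
    f0 \<in> rpo_hom (rg_X0 X) (rg_X0 Y) \<and> f1 \<in> rpo_hom (rg_X1 X) (rg_X1 Y) \<and>
    (\<forall>a\<in>carrier (rg_X1 X). rg_d Y (f1 a) = f0 (rg_d X a) \<and> rg_c Y (f1 a) = f0 (rg_c X a)) \<and>
    (\<forall>x\<in>carrier (rg_X0 X). f1 (rg_e X x) = rg_e Y (f0 x))"
  by (auto simp: SchRG_def RG_def refl_graph_hom_def RPOGrp_def compose_def fun_eq_iff)

locale schreier_graph_pair =
  X: schreier_graph X + Y: schreier_graph Y for X Y :: "('a rpogroup, 'a \<Rightarrow> 'a) refl_graph"
begin

text \<open>Commuting with \<open>d\<close> makes \<open>f1\<close> preserve kernels; commuting with
  \<open>e\<close> makes it respect conjugation by elements \<open>e x\<close>, hence the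
  actions.\<close>

lemma ker_map_hom:
  assumes "f \<in> Hom SchRG X Y"
  shows "ker_map X Y f \<in> Hom S_PXMod X.ker_precrossed Y.ker_precrossed"
proof -
  obtain f0 f1 where f: "f = (f0, f1)" by fastforce
  have f0: "f0 \<in> rpo_hom X.B Y.B" and f1: "f1 \<in> rpo_hom X.A Y.A"
    and [simp]: "\<And>a. a \<in> carrier X.A \<Longrightarrow> Y.d (f1 a) = f0 (X.d a)"
      "\<And>a. a \<in> carrier X.A \<Longrightarrow> f0 (X.c a) = Y.c (f1 a)"
      "\<And>x. x \<in> carrier X.B \<Longrightarrow> f1 (X.e x) = Y.e (f0 x)"
    using assms Hom_SchRG[OF X.obj Y.obj] unfolding f by auto
  note [simp] = rpo_homD(3-5)[OF f0] rpo_homD(3-5)[OF f1]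
    rpo_hom_group[OF X.rpo_B Y.rpo_B f0] rpo_hom_group[OF X.rpo_A Y.rpo_A f1]
  have "restrict f1 (carrier X.K) \<in> rpo_hom X.K Y.K"
    by (auto simp: rpo_hom_def hom_def X.A.cone_carrier)
  then show ?thesis
    using f0 by (auto simp: f ker_map_def S_PXMod_def precrossed_hom_def X.act_apply Y.act_apply)
qed

lemma ker_map_bij: "bij_betw (ker_map X Y) (Hom SchRG X Y) (Hom S_PXMod X.ker_precrossed Y.ker_precrossed)"
proof (intro bij_betwI')
  fix f g assume f: "f \<in> Hom SchRG X Y" and g: "g \<in> Hom SchRG X Y"
  obtain f0 f1 g0 g1 where fg: "f = (f0, f1)" "g = (g0, g1)" by fastforce
  note f = f[unfolded fg Hom_SchRG[OF X.obj Y.obj]] and g = g[unfolded fg Hom_SchRG[OF X.obj Y.obj]]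
  \<comment> \<open>Since \<open>a\<close> is the product of \<open>kpart a\<close> and
    \<open>e (d a)\<close>, a morphism of graphs is determined by its values on the kernel and on
    the objects.\<close>
  have decomp: "h1 a = h1 (X.kpart a) \<otimes>\<^bsub>Y.A\<^esub> Y.e (h0 (X.d a))"
    if "h1 \<in> rpo_hom X.A Y.A" "\<forall>x\<in>carrier X.B. h1 (X.e x) = Y.e (h0 x)" "a \<in> carrier X.A"
    for h0 h1 a
    using that X.kpart_simps(4)[of a] rpo_homD(5)[OF that(1), of "X.kpart a" "X.e (X.d a)"] by simp
  show "ker_map X Y f = ker_map X Y g \<longleftrightarrow> f = g"
  proof
    assume eq: "ker_map X Y f = ker_map X Y g"
    then have 0: "f0 = g0" by (simp add: fg ker_map_def)
    have 1: "f1 k = g1 k" if "k \<in> carrier X.K" for k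
      using eq that unfolding fg ker_map_def prod.inject snd_conv by (metis restrict_apply')
    have "f1 = g1"
    proof (rule extensionalityI)
      fix a assume a: "a \<in> carrier X.A"
      then have "f1 (X.kpart a) = g1 (X.kpart a)" by (simp add: 1)
      then show "f1 a = g1 a"
        using a f g decomp[of f1 f0 a] decomp[of g1 g0 a] 0 by simp
    qed (use f g in \<open>auto simp: rpo_homD\<close>)
    with 0 show "f = g" by (simp add: fg)
  qed simp
next
  fix f assume "f \<in> Hom SchRG X Y"
  then show "ker_map X Y f \<in> Hom S_PXMod X.ker_precrossed Y.ker_precrossed"
    by (rule ker_map_hom)
next
  fix g assume "g \<in> Hom S_PXMod X.ker_precrossed Y.ker_precrossed"
  moreover obtain g0 g1 where g: "g = (g0, g1)" by fastforce
  ultimately have g0: "g0 \<in> rpo_hom X.B Y.B" and g1: "g1 \<in> rpo_hom X.K Y.K"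
    and g1_in: "\<And>k. k \<in> carrier X.K \<Longrightarrow> g1 k \<in> carrier Y.K"
    and c_g1: "\<And>k. k \<in> carrier X.K \<Longrightarrow> Y.c (g1 k) = g0 (X.c k)"
    and act_g1: "\<And>x k. \<lbrakk>x \<in> carrier X.B; k \<in> carrier X.K\<rbrakk> \<Longrightarrow> g1 (X.act x k) = Y.act (g0 x) (g1 k)"
    by (auto simp: S_PXMod_def precrossed_hom_def dest: rpo_homD(3))
  note [simp] = rpo_homD(3-5)[OF g0] rpo_homD(4,5)[OF g1, simplified]
    rpo_hom_group[OF X.rpo_B Y.rpo_B g0] rpo_hom_group(1)[OF X.rpo_K Y.rpo_K g1, simplified]
    g1_in[simplified] c_g1[simplified] act_g1[simplified]
  \<comment> \<open>By \<open>decomp\<close> this is the only candidate. It preserves positivity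
    because the Schreier condition makes \<open>kpart a\<close> positive for positive
    \<open>a\<close>.\<close>
  define f1 where "f1 = (\<lambda>a\<in>carrier X.A. g1 (X.kpart a) \<otimes>\<^bsub>Y.A\<^esub> Y.e (g0 (X.d a)))"
  \<comment> \<open>Equivariance of \<open>g1\<close> turns the action in
    \<open>X.kpart_mult\<close> into the action in \<open>Y\<close>, that is, conjugation by
    \<open>Y.e (g0 (X.d a))\<close>, whose inverse then cancels against the adjacent factor.\<close>
  have mult: "f1 (a \<otimes>\<^bsub>X.A\<^esub> b) = f1 a \<otimes>\<^bsub>Y.A\<^esub> f1 b" if a: "a \<in> carrier X.A" and b: "b \<in> carrier X.A" for a b
  proof -
    have "X.act (X.d a) (X.kpart b) \<in> carrier X.K"
      using a b by (simp add: X.act_apply)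
    then show ?thesis
      using a b by (simp add: f1_def X.kpart_mult) (simp add: Y.act_apply Y.A.m_assoc)
  qed
  have "f1 \<in> rpo_hom X.A Y.A"
    using mult by (auto simp: rpo_hom_def hom_def)
      (auto simp: f1_def X.A.cone_carrier Y.A.cone.m_closed)
  moreover have "Y.c (f1 a) = g0 (X.c a)" if "a \<in> carrier X.A" for a
    using that by (simp add: f1_def X.c_kpart Y.B.m_assoc)
  ultimately have "(g0, f1) \<in> Hom SchRG X Y"
    using g0 by (subst Hom_SchRG[OF X.obj Y.obj]) (simp add: f1_def)
  moreover have "restrict f1 (carrier X.K) = g1"
    using rpo_homD(2)[OF g1]
    by (intro extensionalityI[where A = "carrier X.K"]) (auto simp: f1_def)
  ultimately show "\<exists>f\<in>Hom SchRG X Y. g = ker_map X Y f"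
    by (intro bexI[of _ "(g0, f1)"]) (auto simp: g ker_map_def)
qed

end

lemma ker_functor: "fully_faithful_functor SchRG (S_PXMod :: ('a precrossed, ('a \<Rightarrow> 'a) \<times> ('a \<Rightarrow> 'a)) cat)
    schreier_graph.ker_precrossed ker_map"
proof (intro fully_faithful_functor.intro cat_functor.intro cat_functor_axioms.intro
    fully_faithful_functor_axioms.intro category_SchRG category_S_PXMod)
  fix X :: "('a rpogroup, 'a \<Rightarrow> 'a) refl_graph" assume "X \<in> Obj SchRG"
  then interpret X: schreier_graph X by unfold_locales
  show "X.ker_precrossed \<in> Obj S_PXMod" by (rule X.ker_precrossed_Obj)
  show "ker_map X X (Ident SchRG X) = Ident S_PXMod X.ker_precrossed"
    by (auto simp: ker_map_def SchRG_def RG_def RPOGrp_def S_PXMod_def)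
next
  fix X Y :: "('a rpogroup, 'a \<Rightarrow> 'a) refl_graph" assume "X \<in> Obj SchRG" "Y \<in> Obj SchRG"
  then interpret schreier_graph_pair X Y by unfold_locales
  show "bij_betw (ker_map X Y) (Hom SchRG X Y) (Hom S_PXMod X.ker_precrossed Y.ker_precrossed)"
    by (rule ker_map_bij)
  show "ker_map X Y f \<in> Hom S_PXMod X.ker_precrossed Y.ker_precrossed" if "f \<in> Hom SchRG X Y" for f
    using that by (rule ker_map_hom)
next
  fix X Y Z :: "('a rpogroup, 'a \<Rightarrow> 'a) refl_graph" and f g
  assume X: "X \<in> Obj SchRG" and Y: "Y \<in> Obj SchRG" and Z: "Z \<in> Obj SchRG"
    and f: "f \<in> Hom SchRG X Y" and g: "g \<in> Hom SchRG Y Z"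
  interpret schreier_graph_pair X Y using X Y by unfold_locales
  obtain f0 f1 where f_eq: "f = (f0, f1)" by fastforce
  \<comment> \<open>Composing the restrictions agrees with restricting the composite only because
    \<open>f1\<close> maps \<open>X.K\<close> into \<open>Y.K\<close>.\<close>
  have "restrict f1 (carrier X.K) \<in> rpo_hom X.K Y.K"
    using ker_map_hom[OF f] by (simp add: f_eq ker_map_def S_PXMod_def precrossed_hom_def)
  from rpo_homD(3)[OF this] have "\<And>k. k \<in> carrier X.K \<Longrightarrow> f1 k \<in> carrier Y.K" by simp
  then show "ker_map X Z (Comp SchRG X Y Z g f)
      = Comp S_PXMod X.ker_precrossed Y.ker_precrossed (schreier_graph.ker_precrossed Z)
          (ker_map Y Z g) (ker_map X Y f)"
    by (auto simp: f_eq ker_map_def SchRG_def RG_def RPOGrp_def S_PXMod_def compose_def)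
qed

section \<open>The semidirect product of a precrossed module\<close>

locale precrossed_encoding = S_precrossed_module M for M :: "'a precrossed" +
  fixes p :: "'a \<times> 'a \<Rightarrow> 'a"
  assumes inj: "inj p"
begin

abbreviation "A \<equiv> px_X1 M"
abbreviation "B \<equiv> px_X0 M"
abbreviation "bd \<equiv> px_bd M"
abbreviation "act \<equiv> px_act M"

sublocale A: right_preordered_group A by (rule X1)
sublocale B: right_preordered_group B by (rule X0)

lemma act_auto: "x \<in> carrier B \<Longrightarrow> act x \<in> auto A"
  using rpo_homD(3)[OF act_hom] by (simp add: rpo_Aut_def AutoGroup_def)

lemma act_closed [simp]: "\<lbrakk>x \<in> carrier B; a \<in> carrier A\<rbrakk> \<Longrightarrow> act x a \<in> carrier A"
  and act_mult [simp]: "\<lbrakk>x \<in> carrier B; a \<in> carrier A; b \<in> carrier A\<rbrakk>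
    \<Longrightarrow> act x (a \<otimes>\<^bsub>A\<^esub> b) = act x a \<otimes>\<^bsub>A\<^esub> act x b"
  using act_auto[of x] by (auto simp: auto_def hom_def)

lemma act_one [simp]: "x \<in> carrier B \<Longrightarrow> act x \<one>\<^bsub>A\<^esub> = \<one>\<^bsub>A\<^esub>"
  using act_mult[of x "\<one>\<^bsub>A\<^esub>" "\<one>\<^bsub>A\<^esub>"] A.l_cancel_one'[of "act x \<one>\<^bsub>A\<^esub>" "act x \<one>\<^bsub>A\<^esub>"] by simp

lemma one_act [simp]: "a \<in> carrier A \<Longrightarrow> act \<one>\<^bsub>B\<^esub> a = a"
  using rpo_hom_group(1)[OF X0 right_preordered_group_rpo_Aut[OF X1] act_hom]
  by (simp add: rpo_Aut_def AutoGroup_def BijGroup_def)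

lemma mult_act: "\<lbrakk>x \<in> carrier B; y \<in> carrier B; a \<in> carrier A\<rbrakk>
    \<Longrightarrow> act (x \<otimes>\<^bsub>B\<^esub> y) a = act x (act y a)"
  using rpo_homD(5)[OF act_hom, of x y] act_auto[of x] act_auto[of y]
  by (simp add: rpo_Aut_def AutoGroup_def BijGroup_def auto_def compose_eq)

lemma act_cone [simp]: "\<lbrakk>x \<in> cone B; a \<in> cone A\<rbrakk> \<Longrightarrow> act x a \<in> cone A"
  using rpo_homD(4)[OF act_hom, of x] by (auto simp: rpo_Aut_def)

lemmas bd_simps [simp] = bd_hom[THEN rpo_homD(3)] bd_hom[THEN rpo_homD(4)]
  bd_hom[THEN rpo_homD(5)] rpo_hom_group[OF X1 X0 bd_hom]

lemma B_cancel [simp]: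
  "\<lbrakk>x \<in> carrier B; y \<in> carrier B\<rbrakk> \<Longrightarrow> inv\<^bsub>B\<^esub> x \<otimes>\<^bsub>B\<^esub> (x \<otimes>\<^bsub>B\<^esub> y) = y"
  by (simp flip: B.m_assoc)

lemma p_eq_iff [simp]: "p u = p v \<longleftrightarrow> u = v"
  using inj by (simp add: inj_eq)

text \<open>\<open>q1\<close> and \<open>q2\<close> decode the coordinates of a pair. They are
  meaningful on the range of \<open>p\<close>, which contains every carrier they are applied
  to.\<close>

definition q1 :: "'a \<Rightarrow> 'a" where "q1 u = fst (inv_into UNIV p u)"
definition q2 :: "'a \<Rightarrow> 'a" where "q2 u = snd (inv_into UNIV p u)"

lemma q_simps [simp]: "q1 (p (a, x)) = a" "q2 (p (a, x)) = x"
  by (simp_all add: q1_def q2_def inv_f_f[OF inj])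

text \<open>The semidirect product of \<open>A\<close> by \<open>B\<close>, transported along
  \<open>p\<close>. The coordinate in \<open>A\<close> comes first, matching the factorisation of
  \<open>a\<close> into \<open>kpart a\<close> and \<open>e (d a)\<close>.\<close>

definition sdp :: "'a rpogroup" where
  "sdp = \<lparr>
    carrier = p ` (carrier A \<times> carrier B),
    mult = (\<lambda>u v. p (q1 u \<otimes>\<^bsub>A\<^esub> act (q2 u) (q1 v), q2 u \<otimes>\<^bsub>B\<^esub> q2 v)),
    one = p (\<one>\<^bsub>A\<^esub>, \<one>\<^bsub>B\<^esub>),
    cone = p ` (cone A \<times> cone B)\<rparr>"

lemma sdp_simps [simp]:
  "carrier sdp = p ` (carrier A \<times> carrier B)" "cone sdp = p ` (cone A \<times> cone B)"
  "\<one>\<^bsub>sdp\<^esub> = p (\<one>\<^bsub>A\<^esub>, \<one>\<^bsub>B\<^esub>)"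
  "p (a, x) \<otimes>\<^bsub>sdp\<^esub> p (b, y) = p (a \<otimes>\<^bsub>A\<^esub> act x b, x \<otimes>\<^bsub>B\<^esub> y)"
  by (simp_all add: sdp_def)

lemma rpo_sdp: "right_preordered_group sdp"
proof -
  have "group sdp"
  proof (rule groupI)
    fix u assume "u \<in> carrier sdp"
    then obtain a x where u: "u = p (a, x)" "a \<in> carrier A" "x \<in> carrier B" by auto
    \<comment> \<open>With \<open>inv x\<close> acting on \<open>inv a\<close>, the first coordinate
      of the product is \<open>inv x\<close> acting on \<open>inv a\<close> times \<open>a\<close>,
      which is the unit.\<close>
    show "\<exists>v\<in>carrier sdp. v \<otimes>\<^bsub>sdp\<^esub> u = \<one>\<^bsub>sdp\<^esub>"
      using u by (intro bexI[of _ "p (act (inv\<^bsub>B\<^esub> x) (inv\<^bsub>A\<^esub> a), inv\<^bsub>B\<^esub> x)"]) (auto simp flip: act_mult)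
  qed (auto simp: A.m_assoc B.m_assoc mult_act)
  \<comment> \<open>Closure of the product cone rests on \<open>act_cone\<close>: positive elements
    of \<open>B\<close> act by maps preserving the cone of \<open>A\<close>.\<close>
  moreover have "submonoid (cone sdp) sdp"
  proof (rule submonoid.intro)
    show "cone sdp \<subseteq> carrier sdp" by (auto simp: A.cone_carrier B.cone_carrier)
  qed (auto simp: A.cone.m_closed B.cone.m_closed)
  ultimately show ?thesis by (simp add: right_preordered_group_def)
qed

sublocale sdp: right_preordered_group sdp by (rule rpo_sdp)

lemma inv_sdp: "x \<in> carrier B \<Longrightarrow> inv\<^bsub>sdp\<^esub> p (\<one>\<^bsub>A\<^esub>, x) = p (\<one>\<^bsub>A\<^esub>, inv\<^bsub>B\<^esub> x)"
  by (intro sdp.inv_equality) auto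

text \<open>The formula for \<open>rg_c\<close> is forced: \<open>(a, x)\<close> is the product of
  \<open>(a, 1)\<close> and \<open>(1, x)\<close>, and \<open>c\<close> must be \<open>bd\<close> on
  the kernel and undo \<open>e\<close>.\<close>

definition sdp_graph :: "('a rpogroup, 'a \<Rightarrow> 'a) refl_graph" where
  "sdp_graph = \<lparr>rg_X1 = sdp, rg_X0 = B, rg_d = restrict q2 (carrier sdp),
    rg_c = (\<lambda>u\<in>carrier sdp. bd (q1 u) \<otimes>\<^bsub>B\<^esub> q2 u),
    rg_e = (\<lambda>x\<in>carrier B. p (\<one>\<^bsub>A\<^esub>, x))\<rparr>"

lemma sdp_graph_Obj: "sdp_graph \<in> Obj SchRG"
proof -
  have 1: "restrict q2 (carrier sdp) \<in> rpo_hom sdp B"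
    by (auto simp: rpo_hom_def hom_def A.cone_carrier B.cone_carrier)
  \<comment> \<open>Multiplicativity of \<open>c\<close> is where the precrossed identity enters: it
    rewrites \<open>bd (act x b)\<close> as a conjugate by \<open>x\<close>, and the trailing
    \<open>inv x\<close> cancels.\<close>
  have 2: "(\<lambda>u\<in>carrier sdp. bd (q1 u) \<otimes>\<^bsub>B\<^esub> q2 u) \<in> rpo_hom sdp B"
    by (auto simp: rpo_hom_def hom_def A.cone_carrier B.cone_carrier B.cone.m_closed
        precrossed B.m_assoc)
  have 3: "(\<lambda>x\<in>carrier B. p (\<one>\<^bsub>A\<^esub>, x)) \<in> rpo_hom B sdp"
    by (auto simp: rpo_hom_def hom_def B.cone_carrier)
  \<comment> \<open>For the Schreier condition, \<open>(a, x)\<close> times the inverse of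
    \<open>(1, x)\<close> is \<open>(a, 1)\<close>, which is positive whenever \<open>a\<close>
    is.\<close>
  show ?thesis
    using 1 2 3
    by (auto simp: Obj_SchRG reflexive_graph_def sdp_graph_def RPOGrp_def rpo_sdp X0
        compose_def fun_eq_iff inv_sdp A.cone_carrier B.cone_carrier)
qed

sublocale sdp_graph: schreier_graph sdp_graph
  by unfold_locales (rule sdp_graph_Obj)

lemma sdp_graph_simps [simp]:
  "rg_X0 sdp_graph = B" "rg_X1 sdp_graph = sdp"
  "\<lbrakk>a \<in> carrier A; x \<in> carrier B\<rbrakk> \<Longrightarrow> rg_d sdp_graph (p (a, x)) = x"
  "\<lbrakk>a \<in> carrier A; x \<in> carrier B\<rbrakk> \<Longrightarrow> rg_c sdp_graph (p (a, x)) = bd a \<otimes>\<^bsub>B\<^esub> x"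
  "x \<in> carrier B \<Longrightarrow> rg_e sdp_graph x = p (\<one>\<^bsub>A\<^esub>, x)"
  by (simp_all add: sdp_graph_def)

lemma K_iff:
  "u \<in> carrier sdp_graph.K \<longleftrightarrow> (\<exists>a\<in>carrier A. u = p (a, \<one>\<^bsub>B\<^esub>))"
  "u \<in> cone sdp_graph.K \<longleftrightarrow> (\<exists>a\<in>cone A. u = p (a, \<one>\<^bsub>B\<^esub>))"
  by (auto simp: A.cone_carrier B.cone_carrier)

text \<open>Conjugating \<open>(a, 1)\<close> by \<open>(1, x)\<close> recovers the given action;
  this makes the isomorphism between \<open>A\<close> and the kernel equivariant.\<close>

lemma sdp_act:
  assumes "x \<in> carrier B" "a \<in> carrier A"
  shows "sdp_graph.act x (p (a, \<one>\<^bsub>B\<^esub>)) = p (act x a, \<one>\<^bsub>B\<^esub>)"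
  using assms by (subst sdp_graph.act_apply) (auto simp: inv_sdp)

lemma sdp_ker_iso:
  "\<exists>f. is_isomorphism S_PXMod sdp_graph.ker_precrossed M f"
proof
  define r where "r = restrict q1 (carrier sdp_graph.K)"
  define s where "s = (\<lambda>a\<in>carrier A. p (a, \<one>\<^bsub>B\<^esub>))"
  \<comment> \<open>Kernel elements are put in the form \<open>p (a, 1)\<close> instead of being
    described by membership conditions, so that all later checks become computations in
    coordinates.\<close>
  note K = K_iff sdp_graph.K_simps(3,4)
  have s: "s \<in> rpo_hom A sdp_graph.K"
    unfolding rpo_hom_def s_def
    by (auto simp: hom_def K A.cone_carrier simp del: sdp_graph.K_simps(1,2))
  have rp [simp]: "r (p (a, \<one>\<^bsub>B\<^esub>)) = a" if "a \<in> carrier A" for a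
    using that by (simp add: r_def)
  have "r \<in> extensional (carrier sdp_graph.K)" by (simp add: r_def)
  then have r: "r \<in> rpo_hom sdp_graph.K A"
    by (auto simp: rpo_hom_def hom_def K A.cone_carrier simp del: sdp_graph.K_simps(1,2))
  have sp [simp]: "s a = p (a, \<one>\<^bsub>B\<^esub>)" if "a \<in> carrier A" for a
    using that by (simp add: s_def)
  show "is_isomorphism S_PXMod sdp_graph.ker_precrossed M (\<lambda>x\<in>carrier B. x, r)"
  proof (rule is_isomorphismI[where g = "(\<lambda>x\<in>carrier B. x, s)"])
    show "(\<lambda>x\<in>carrier B. x, r) \<in> Hom S_PXMod sdp_graph.ker_precrossed M"
      using r rpo_hom_ident[OF X0]
      by (auto simp: S_PXMod_def precrossed_hom_def K sdp_act simp del: sdp_graph.K_simps(1,2))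
    show "(\<lambda>x\<in>carrier B. x, s) \<in> Hom S_PXMod M sdp_graph.ker_precrossed"
      using s rpo_hom_ident[OF X0]
      by (auto simp: S_PXMod_def precrossed_hom_def K sdp_act simp del: sdp_graph.K_simps(1,2))
  qed (auto simp: S_PXMod_def compose_def fun_eq_iff K simp del: sdp_graph.K_simps(1,2))
qed

end

theorem mainTheorem14:
  assumes "infinite (UNIV :: 'u set)"
  shows "equivalent_categories
    (SchRG :: (('u rpogroup, 'u \<Rightarrow> 'u) refl_graph, ('u \<Rightarrow> 'u) \<times> ('u \<Rightarrow> 'u)) cat)
    (S_PXMod :: ('u precrossed, ('u \<Rightarrow> 'u) \<times> ('u \<Rightarrow> 'u)) cat)"
proof (rule fully_faithful_functor.equivalent_if_essentially_surjective[OF ker_functor])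
  fix M :: "'u precrossed" assume "M \<in> Obj S_PXMod"
  then have M: "S_precrossed_module M" by (simp add: S_PXMod_def)
  \<comment> \<open>An infinite type has the cardinality of its square, so pairs can be encoded in
    it.\<close>
  obtain p :: "'u \<times> 'u \<Rightarrow> 'u" where "inj p"
    using card_of_Times_same_infinite[OF assms] unfolding card_of_ordIso[symmetric]
    by (auto simp: bij_betw_def)
  with M interpret precrossed_encoding M p
    by (simp add: precrossed_encoding_def precrossed_encoding_axioms_def)
  show "\<exists>X\<in>Obj SchRG. \<exists>f. is_isomorphism S_PXMod (schreier_graph.ker_precrossed X) M f"
    using sdp_graph_Obj sdp_ker_iso by blast
qed

end
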